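(* For all integers $n\ge 0$ and $r\ge 0$, \[ B_{n,r}^{L}(x)=e^{-x}\sum_{k=0}^{\infty}\frac{\langle k+2r\rangle_{n}}{k!}x^{k}. \]
   Context: For a nonnegative integer $r$ and integers $0\le k\le n$, the $r$-Lah number $L_r(n,k)$ is the number of partitions of a set with $n+r$ elements into $k+r$ non-empty linearly ordered subsets such that $r$ distinguished elements lie in distinct subsets; equivalently $L_r(n,k)=\frac{n!}{k!}\binom{n+2r-1}{k+2r-1}$, with exponential generating function $\sum_{n\ge k}L_r(n,k)\frac{t^n}{n!}=\frac{1}{k!}\left(\frac{1}{1-t}-1\right)^k\left(\frac{1}{1-t}\right)^{2r}$. The $r$-extended Lah-Bell polynomials are $B^L_{n,r}(x)=\sum_{k=0}^n L_r(n,k)x^k$. The rising factorial is $\langle x\rangle_0=1$, $\langle x\rangle_n=x(x+1)\cdots(x+n-1)$ for $n\ge1$. *)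

theory Defs
  imports Complex_Main "HOL-Library.Disjoint_Sets"
begin

text \<open>A linearly ordered subset of \<open>A\<close> is a repetition-free list over \<open>A\<close>. A partition of \<open>A\<close>
  into non-empty linearly ordered subsets is a set of such lists whose underlying sets are the
  blocks of a partition of \<open>A\<close>; injectivity of \<^term>\<open>set\<close> says that every block carries exactly
  one order.\<close>

definition ordered_block_partition :: "'a set \<Rightarrow> 'a list set \<Rightarrow> bool" where
  "ordered_block_partition A P \<longleftrightarrow>
     partition_on A (set ` P) \<and> inj_on set P \<and> (\<forall>xs\<in>P. distinct xs)"

text \<open>The underlying set with \<open>n + r\<close> elements is \<open>{..<n + r}\<close>, and its distinguished elements
  are those of \<open>{..<r}\<close>.\<close>

definition r_Lah :: "nat \<Rightarrow> nat \<Rightarrow> nat \<Rightarrow> nat" where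
  "r_Lah r n k = card {P. ordered_block_partition {..<n + r} P \<and> card P = k + r \<and>
     (\<forall>xs\<in>P. \<forall>i<r. \<forall>j<r. i \<in> set xs \<and> j \<in> set xs \<longrightarrow> i = j)}"

definition Lah_Bell_poly :: "nat \<Rightarrow> nat \<Rightarrow> 'a \<Rightarrow> 'a::comm_semiring_1" where
  "Lah_Bell_poly n r x = (\<Sum>k\<le>n. of_nat (r_Lah r n k) * x ^ k)"

end

theory Submission imports Defs begin

text \<open>Deleting the largest element from a partition into lists gives
  \<open>L\<^sub>r(n+1,k) = L\<^sub>r(n,k-1) + (n+k+2r) L\<^sub>r(n,k)\<close>: either the element was a block of its own, or
  it was inserted at one of the \<open>(n + r) + (k + r)\<close> positions in the remaining lists.
  The recurrence says exactly that the numbers \<open>L\<^sub>r(n,k)\<close> are the coefficients of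
  \<open>\<langle>m+2r\<rangle>\<^sub>n\<close> in the basis of falling factorials of \<open>m\<close>. Since the series of
  \<open>m(m-1)\<dots>(m-k+1) x\<^sup>m / m!\<close> sums to \<open>x\<^sup>k e\<^sup>x\<close>, the formula follows by linearity.\<close>

section \<open>Partitions into lists with distinguished elements\<close>

text \<open>Arbitrary sets replace the initial segments, and \<open>D\<close> need not lie in
  \<open>A\<close>. A block can thus be split off by shrinking the ground set while \<open>D\<close>
  stays fixed.\<close>

definition lah_partition :: "'a set \<Rightarrow> 'a set \<Rightarrow> 'a list set \<Rightarrow> bool" where
  "lah_partition A D P \<longleftrightarrow> ordered_block_partition A P \<and>
     (\<forall>xs\<in>P. \<forall>i\<in>D. \<forall>j\<in>D. i \<in> set xs \<and> j \<in> set xs \<longrightarrow> i = j)"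

definition lah_partitions :: "'a set \<Rightarrow> 'a set \<Rightarrow> nat \<Rightarrow> 'a list set set" where
  "lah_partitions A D m = {P. lah_partition A D P \<and> card P = m}"

lemma r_Lah_eq_card: "r_Lah r n k = card (lah_partitions {..<n + r} {..<r} (k + r))"
  unfolding r_Lah_def lah_partitions_def lah_partition_def
  by (rule arg_cong[where f = card]) auto

text \<open>Two different non-empty lists with the same underlying set would intersect. Hence
  injectivity of \<open>set\<close> and disjointness of the blocks together amount to disjointness
  of any two different lists.\<close>

lemma lah_partition_iff:
  "lah_partition A D P \<longleftrightarrow>
     (\<forall>xs\<in>P. xs \<noteq> [] \<and> distinct xs \<and> (\<forall>i\<in>D. \<forall>j\<in>D. i \<in> set xs \<and> j \<in> set xs \<longrightarrow> i = j)) \<and>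
     (\<forall>xs\<in>P. \<forall>ys\<in>P. xs \<noteq> ys \<longrightarrow> set xs \<inter> set ys = {}) \<and> (\<Union>xs\<in>P. set xs) = A"
proof -
  have "inj_on set P \<and> disjoint (set ` P) \<longleftrightarrow>
      (\<forall>xs\<in>P. \<forall>ys\<in>P. xs \<noteq> ys \<longrightarrow> set xs \<inter> set ys = {})" if "\<forall>xs\<in>P. xs \<noteq> []"
    using that by (fastforce simp: inj_on_def disjoint_def)
  then show ?thesis
    unfolding lah_partition_def ordered_block_partition_def partition_on_def by auto
qed

text \<open>This isolates one block from the remaining blocks \<open>R\<close>, so that the block
  can be removed or exchanged without touching \<open>R\<close>.\<close>

lemma lah_partition_insert_iff:
  assumes "xs \<notin> R"
  shows "lah_partition A D (insert xs R) \<longleftrightarrow>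
    xs \<noteq> [] \<and> distinct xs \<and> (\<forall>i\<in>D. \<forall>j\<in>D. i \<in> set xs \<and> j \<in> set xs \<longrightarrow> i = j) \<and>
    set xs \<subseteq> A \<and> lah_partition (A - set xs) D R"
    (is "?L \<longleftrightarrow> ?R")
proof
  assume L: ?L
  then have dj: "set xs \<inter> set ys = {}" if "ys \<in> R" for ys
    using assms that unfolding lah_partition_iff by (metis insertI1 insertI2)
  have "(\<Union>ys\<in>R. set ys) = A - set xs"
    using L dj unfolding lah_partition_iff by auto
  then show ?R
    using L unfolding lah_partition_iff by auto
next
  assume R: ?R
  then have "set xs \<inter> set ys = {}" if "ys \<in> R" for ys
    using that unfolding lah_partition_iff by auto
  moreover have "(\<Union>ys\<in>insert xs R. set ys) = A"
    using R unfolding lah_partition_iff by auto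
  ultimately show ?L
    using R unfolding lah_partition_iff by (auto simp: Int_commute)
qed

lemma lah_partition_notin:
  assumes "lah_partition A D P" and "a \<in> set xs" and "a \<notin> A"
  shows "xs \<notin> P"
  using assms unfolding lah_partition_iff by auto

lemma finite_lah_partition:
  assumes "finite A" and "lah_partition A D P"
  shows "finite P"
proof (rule finite_subset)
  show "P \<subseteq> {xs. distinct xs \<and> set xs \<subseteq> A}"
    using assms(2) unfolding lah_partition_iff by auto
  show "finite {xs. distinct xs \<and> set xs \<subseteq> A}"
    using finite_subset_distinct[OF assms(1)] by (simp add: conj_commute)
qed

lemma finite_lah_partitions:
  assumes "finite A"
  shows "finite (lah_partitions A D m)"
proof (rule finite_subset)
  show "lah_partitions A D m \<subseteq> Pow {xs. distinct xs \<and> set xs \<subseteq> A}"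
    unfolding lah_partitions_def lah_partition_iff by auto
  show "finite (Pow {xs. distinct xs \<and> set xs \<subseteq> A})"
    using finite_subset_distinct[OF assms] by (simp add: conj_commute)
qed

text \<open>Pigeonhole: sending each distinguished element to a list containing it is injective,
  since no list contains two of them.\<close>

lemma card_distinguished_le:
  assumes "finite A" and "D \<subseteq> A" and "lah_partition A D P"
  shows "card D \<le> card P"
proof -
  have "\<exists>xs\<in>P. d \<in> set xs" if "d \<in> D" for d
    using assms that unfolding lah_partition_iff by auto
  then obtain f where f: "\<And>d. d \<in> D \<Longrightarrow> f d \<in> P \<and> d \<in> set (f d)"
    by metis
  have "inj_on f D"
    by (rule inj_onI) (use f assms(3) in \<open>metis lah_partition_def\<close>)
  then show ?thesis
    using f finite_lah_partition[OF assms(1,3)] by (intro card_inj_on_le) auto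
qed

lemma lah_partitions_empty:
  assumes "finite A" and "D \<subseteq> A" and "m < card D"
  shows "lah_partitions A D m = {}"
  using card_distinguished_le[OF assms(1,2)] assms(3) unfolding lah_partitions_def by force

section \<open>Counting insertion positions\<close>

lemma sum_length_lah_partition:
  assumes "finite A" and "lah_partition A D P"
  shows "(\<Sum>xs\<in>P. length xs) = card A"
proof -
  have "(\<Sum>xs\<in>P. length xs) = (\<Sum>xs\<in>P. card (set xs))"
    using assms(2) unfolding lah_partition_iff by (intro sum.cong) (auto simp: distinct_card)
  also have "\<dots> = card (\<Union>xs\<in>P. set xs)"
    using assms finite_lah_partition[OF assms]
    unfolding lah_partition_iff by (intro card_UN_disjoint[symmetric]) auto
  finally show ?thesis
    using assms(2) unfolding lah_partition_iff by simp
qed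

text \<open>A way of cutting \<open>xs\<close> in two is a gap at which a new element can be
  inserted. It is determined by the length of the front part, which ranges from 0 to
  \<open>length xs\<close>.\<close>

lemma splits_eq_image: "{(ys, zs). ys @ zs = xs} = (\<lambda>i. (take i xs, drop i xs)) ` {..length xs}"
proof (intro equalityI subsetI)
  fix p assume "p \<in> {(ys, zs). ys @ zs = xs}"
  then have "p = (take (length (fst p)) xs, drop (length (fst p)) xs)" "length (fst p) \<le> length xs"
    by auto
  then show "p \<in> (\<lambda>i. (take i xs, drop i xs)) ` {..length xs}"
    by blast
qed auto

lemma finite_splits: "finite {(ys, zs). ys @ zs = xs}"
  unfolding splits_eq_image by (rule finite_imageI) simp

lemma card_splits: "card {(ys, zs). ys @ zs = xs} = Suc (length xs)"
proof -
  have "inj_on (\<lambda>i. (take i xs, drop i xs)) {..length xs}"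
    by (rule inj_onI) (metis Pair_inject atMost_iff length_take min.absorb2)
  then show ?thesis
    by (simp add: splits_eq_image card_image)
qed

text \<open>A list \<open>xs\<close> offers \<open>length xs + 1\<close> gaps. Over all blocks the
  lengths add up to \<open>card A\<close>, and the extra ones contribute
  \<open>card P\<close>.\<close>

lemma card_insertion_positions:
  assumes "finite A" and "lah_partition A D P"
  shows "card {(ys, zs). ys @ zs \<in> P} = card A + card P"
proof -
  have "{(ys, zs). ys @ zs \<in> P} = (\<Union>xs\<in>P. {(ys, zs). ys @ zs = xs})"
    by auto
  also have "card \<dots> = (\<Sum>xs\<in>P. card {(ys, zs). ys @ zs = xs})"
    using finite_lah_partition[OF assms]
    by (intro card_UN_disjoint) (auto simp: finite_splits)
  also have "\<dots> = card A + card P"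
    by (simp add: card_splits sum_Suc sum_length_lah_partition[OF assms])
  finally show ?thesis .
qed

section \<open>Deleting and inserting a new element\<close>

lemma card_insert_Diff_singleton_if_notin:
  assumes "finite P" "x \<in> P" "y \<notin> P - {x}"
  shows "card (insert y (P - {x})) = card P"
  using assms by (metis card_insert_disjoint card_Suc_Diff1 finite_Diff)

lemma singleton_insertion_lah_partitions:
  assumes "a \<notin> A" and "a \<notin> D" and "finite A"
  shows "{P \<in> lah_partitions (insert a A) D (Suc m). [a] \<in> P} = insert [a] ` lah_partitions A D m"
    (is "?L = ?R")
proof
  show "?L \<subseteq> ?R"
  proof
    fix P assume P: "P \<in> ?L"
    then have fin: "finite P" and eq: "P = insert [a] (P - {[a]})"
      using assms(3) finite_lah_partition[of "insert a A" D P] by (auto simp: lah_partitions_def)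
    then have "lah_partition (insert a A) D (insert [a] (P - {[a]}))"
      using P by (simp add: lah_partitions_def insert_absorb)
    then have "lah_partition A D (P - {[a]})"
      using assms(1) by (subst (asm) lah_partition_insert_iff) auto
    moreover have "card (P - {[a]}) = m"
      using P fin by (simp add: lah_partitions_def)
    ultimately have "P - {[a]} \<in> lah_partitions A D m"
      by (simp add: lah_partitions_def)
    with eq show "P \<in> ?R"
      by (rule image_eqI)
  qed
  show "?R \<subseteq> ?L"
  proof
    fix P assume "P \<in> ?R"
    then obtain Q where Q: "P = insert [a] Q" "lah_partition A D Q" "card Q = m"
      by (auto simp: lah_partitions_def)
    have "[a] \<notin> Q"
      using Q(2) assms(1) by (intro lah_partition_notin) auto
    then show "P \<in> ?L"
      using Q assms finite_lah_partition[OF assms(3) Q(2)]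
      by (auto simp: lah_partitions_def lah_partition_insert_iff)
  qed
qed

text \<open>Splitting off the displayed block leaves the same ground set for \<open>R\<close> on
  both sides. As \<open>a\<close> is not distinguished, adding it to a block creates no conflict
  within \<open>D\<close>.\<close>

lemma lah_partition_insert_element_iff:
  assumes "a \<notin> A" and "a \<notin> D" and "ys @ zs \<noteq> []" and "ys @ a # zs \<notin> R" and "ys @ zs \<notin> R"
  shows "lah_partition (insert a A) D (insert (ys @ a # zs) R) \<and> a \<notin> set ys \<union> set zs \<longleftrightarrow>
    lah_partition A D (insert (ys @ zs) R)"
proof -
  have "insert a A - set (ys @ a # zs) = A - set (ys @ zs)"
    using assms(1) by auto
  then show ?thesis
    using assms by (auto simp: lah_partition_insert_iff)
qed

text \<open>If \<open>[a]\<close> is not a block, the list containing \<open>a\<close> stays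
  non-empty after \<open>a\<close> is deleted, so the number of blocks is preserved. The triple
  records the smaller partition together with the gap that \<open>a\<close> came from.\<close>

lemma long_insertion_lah_partitions:
  assumes "a \<notin> A" and "a \<notin> D" and "finite A"
  shows "{P \<in> lah_partitions (insert a A) D m. [a] \<notin> P} =
    (\<lambda>(Q, ys, zs). insert (ys @ a # zs) (Q - {ys @ zs})) `
      (SIGMA Q:lah_partitions A D m. {(ys, zs). ys @ zs \<in> Q})"
    (is "?L = ?f ` ?S")
proof
  show "?L \<subseteq> ?f ` ?S"
  proof
    fix P assume P: "P \<in> ?L"
    then have lP: "lah_partition (insert a A) D P" and cP: "card P = m" and aP: "[a] \<notin> P"
      by (auto simp: lah_partitions_def)
    have fin: "finite P"
      using finite_lah_partition[OF _ lP] assms(3) by simp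
    obtain xs where xs: "xs \<in> P" "a \<in> set xs"
      using lP unfolding lah_partition_iff by blast
    then obtain ys zs where yz: "xs = ys @ a # zs"
      by (meson split_list)
    define R where "R = P - {xs}"
    have PR: "P = insert (ys @ a # zs) R" "ys @ a # zs \<notin> R"
      using xs yz by (auto simp: R_def)
    have ne: "ys @ zs \<noteq> []"
      using aP xs yz by auto
    have R: "lah_partition (insert a A - set xs) D R" and dist: "distinct xs"
      using lP PR yz by (auto simp: lah_partition_insert_iff)
    \<comment> \<open>An element of the shortened block lies outside the ground set of
      \<open>R\<close>. It witnesses that this block is not already in \<open>R\<close>, so putting
      it back restores the cardinality \<open>m\<close>.\<close>
    obtain b where b: "b \<in> set (ys @ zs)"
      using ne hd_in_set by blast
    have nR: "ys @ zs \<notin> R"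
      by (rule lah_partition_notin[OF R b]) (use b yz in auto)
    have "lah_partition A D (insert (ys @ zs) R)"
      using lP PR dist yz
      by (subst lah_partition_insert_element_iff[OF assms(1,2) ne PR(2) nR, symmetric]) auto
    moreover have "card (insert (ys @ zs) R) = m"
      using card_insert_Diff_singleton_if_notin[OF fin xs(1), of "ys @ zs"] nR cP
      by (simp add: R_def)
    ultimately have "(insert (ys @ zs) R, ys, zs) \<in> ?S"
      by (auto simp: lah_partitions_def)
    moreover have "P = ?f (insert (ys @ zs) R, ys, zs)"
      using PR nR by auto
    ultimately show "P \<in> ?f ` ?S"
      by blast
  qed
  show "?f ` ?S \<subseteq> ?L"
  proof
    fix P assume "P \<in> ?f ` ?S"
    then obtain Q ys zs where P: "P = insert (ys @ a # zs) (Q - {ys @ zs})" and yz: "ys @ zs \<in> Q"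
      and Q: "lah_partition A D Q" "card Q = m"
      by (auto simp: lah_partitions_def)
    have ne: "ys @ zs \<noteq> []"
      using Q yz unfolding lah_partition_iff by auto
    have notin: "ys @ a # zs \<notin> Q" "[a] \<notin> Q"
      using assms(1) by (simp_all add: lah_partition_notin[OF Q(1), of a])
    have "lah_partition (insert a A) D P"
      using lah_partition_insert_element_iff[OF assms(1,2) ne, of "Q - {ys @ zs}"] notin Q(1) yz
      by (simp add: P insert_absorb)
    moreover have "card P = m"
      using card_insert_Diff_singleton_if_notin[OF finite_lah_partition[OF assms(3) Q(1)] yz]
        notin Q(2) by (simp add: P)
    ultimately show "P \<in> ?L"
      using notin ne by (auto simp: lah_partitions_def P Cons_eq_append_conv)
  qed
qed

text \<open>The enlarged list is recognizable as the only one containing \<open>a\<close>. Since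
  \<open>a\<close> occurs in it once, its place recovers \<open>ys\<close> and \<open>zs\<close>,
  and the untouched lists then recover \<open>Q\<close>.\<close>

lemma inj_on_long_insertion:
  assumes "a \<notin> A"
  shows "inj_on (\<lambda>(Q, ys, zs). insert (ys @ a # zs) (Q - {ys @ zs}))
    (SIGMA Q:lah_partitions A D m. {(ys, zs). ys @ zs \<in> Q})"
    (is "inj_on ?f ?S")
proof (rule inj_onI)
  fix p p' assume p: "p \<in> ?S" "p' \<in> ?S" "?f p = ?f p'"
  obtain Q ys zs Q' ys' zs' where pp: "p = (Q, ys, zs)" "p' = (Q', ys', zs')"
    by (metis prod_cases3)
  have Q: "Q \<in> lah_partitions A D m" "ys @ zs \<in> Q"
    and Q': "Q' \<in> lah_partitions A D m" "ys' @ zs' \<in> Q'"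
    and eq: "insert (ys @ a # zs) (Q - {ys @ zs}) = insert (ys' @ a # zs') (Q' - {ys' @ zs'})"
    using p by (simp_all add: pp)
  have no: "a \<notin> set xs" if "xs \<in> Q \<union> Q'" for xs
    using Q Q' assms that unfolding lah_partitions_def lah_partition_iff by auto
  have notin: "ys @ a # zs \<notin> Q \<union> Q'" "ys' @ a # zs' \<notin> Q \<union> Q'"
    using no by force+
  then have "ys @ a # zs = ys' @ a # zs'"
    using eq by blast
  moreover have "a \<notin> set ys" "a \<notin> set ys'" "a \<notin> set zs" "a \<notin> set zs'"
    using no[of "ys @ zs"] no[of "ys' @ zs'"] Q Q' by auto
  ultimately have "ys = ys'" "zs = zs'"
    by (auto simp: append_eq_append_conv2 Cons_eq_append_conv append_eq_Cons_conv)
  moreover from this have "Q - {ys @ zs} = Q' - {ys @ zs}"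
    using eq notin by (metis Diff_iff UnCI insert_ident)
  ultimately show "p = p'"
    using Q(2) Q'(2) pp by (metis insert_Diff)
qed

lemma card_long_insertion:
  assumes "a \<notin> A" and "a \<notin> D" and "finite A"
  shows "card {P \<in> lah_partitions (insert a A) D m. [a] \<notin> P} =
    (card A + m) * card (lah_partitions A D m)"
proof -
  have fin: "finite {(ys, zs). ys @ zs \<in> Q}" if "Q \<in> lah_partitions A D m" for Q
  proof -
    have "{(ys, zs). ys @ zs \<in> Q} = (\<Union>xs\<in>Q. {(ys, zs). ys @ zs = xs})"
      by auto
    then show ?thesis
      using that finite_lah_partition[OF assms(3)] by (auto simp: lah_partitions_def finite_splits)
  qed
  have "card {P \<in> lah_partitions (insert a A) D m. [a] \<notin> P} =
      card (SIGMA Q:lah_partitions A D m. {(ys, zs). ys @ zs \<in> Q})"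
    unfolding long_insertion_lah_partitions[OF assms]
    by (rule card_image[OF inj_on_long_insertion[OF assms(1)]])
  also have "\<dots> = (\<Sum>Q\<in>lah_partitions A D m. card {(ys, zs). ys @ zs \<in> Q})"
    by (rule card_SigmaI) (use fin finite_lah_partitions[OF assms(3)] in auto)
  also have "\<dots> = (\<Sum>Q\<in>lah_partitions A D m. card A + m)"
    using assms(3) by (intro sum.cong) (auto simp: lah_partitions_def card_insertion_positions)
  finally show ?thesis
    by simp
qed

section \<open>Recurrence for the number of partitions\<close>

text \<open>The cases are whether or not \<open>[a]\<close> is a block. Here all blocks are counted:
  with \<open>card A = n + r\<close> and \<open>m = k + r\<close> the factor becomes
  \<open>n + Suc k + 2 * r\<close>.\<close>

lemma card_lah_partitions_insert:
  assumes "a \<notin> A" and "a \<notin> D" and "finite A"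
  shows "card (lah_partitions (insert a A) D (Suc m)) =
    card (lah_partitions A D m) + (card A + Suc m) * card (lah_partitions A D (Suc m))"
proof -
  let ?S = "lah_partitions (insert a A) D (Suc m)"
  have "?S = {P \<in> ?S. [a] \<in> P} \<union> {P \<in> ?S. [a] \<notin> P}"
    by auto
  also have "card \<dots> = card {P \<in> ?S. [a] \<in> P} + card {P \<in> ?S. [a] \<notin> P}"
    using finite_lah_partitions[of "insert a A"] assms(3) by (intro card_Un_disjoint) auto
  also have "card {P \<in> ?S. [a] \<in> P} = card (lah_partitions A D m)"
  proof -
    have "[a] \<notin> Q" if "Q \<in> lah_partitions A D m" for Q
      using that assms(1) lah_partition_notin[of A D Q a "[a]"] by (auto simp: lah_partitions_def)
    then have "inj_on (insert [a]) (lah_partitions A D m)"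
      by (intro inj_onI) (metis insert_ident)
    then show ?thesis
      by (simp add: singleton_insertion_lah_partitions[OF assms] card_image)
  qed
  finally show ?thesis
    by (simp add: card_long_insertion[OF assms])
qed

text \<open>A non-empty ground set requires at least one block. This settles the boundary
  \<open>k = 0\<close> when there are no distinguished elements.\<close>

lemma card_lah_partitions_insert_0:
  assumes "finite A"
  shows "card (lah_partitions (insert a A) D 0) = 0"
proof -
  have "card P \<noteq> 0" if "lah_partition (insert a A) D P" for P
  proof -
    have "P \<noteq> {}"
      using that unfolding lah_partition_iff by auto
    then show ?thesis
      using finite_lah_partition[OF _ that] assms by simp
  qed
  then have "lah_partitions (insert a A) D 0 = {}"
    by (auto simp: lah_partitions_def)
  then show ?thesis
    by simp
qed

section \<open>Initial values and recurrences of the r-Lah numbers\<close>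

text \<open>When every element is distinguished, no list can hold two elements. The partition into
  singletons is then the only one, which gives the initial row \<open>n = 0\<close>.\<close>

lemma lah_partition_distinguished_iff:
  "lah_partition D D P \<longleftrightarrow> P = (\<lambda>i. [i]) ` D"
proof
  assume P: "lah_partition D D P"
  have single: "\<exists>i. xs = [i]" if "xs \<in> P" for xs
  proof -
    have xs: "xs \<noteq> []" "distinct xs" "set xs \<subseteq> D"
      and eq: "\<forall>i\<in>D. \<forall>j\<in>D. i \<in> set xs \<and> j \<in> set xs \<longrightarrow> i = j"
      using P that unfolding lah_partition_iff by auto
    obtain y ys where y: "xs = y # ys"
      using xs(1) by (cases xs) auto
    have "z \<notin> set ys" for z
      using eq[THEN bspec, of y, THEN bspec, of z] xs y by auto
    then show ?thesis
      using y by (cases ys) auto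
  qed
  have D: "D = (\<Union>xs\<in>P. set xs)"
    using P unfolding lah_partition_iff by blast
  show "P = (\<lambda>i. [i]) ` D"
  proof (rule equalityI; rule subsetI)
    fix xs assume "xs \<in> P"
    then show "xs \<in> (\<lambda>i. [i]) ` D"
      using single[of xs] D by (auto intro!: imageI)
  next
    fix xs assume "xs \<in> (\<lambda>i. [i]) ` D"
    then obtain i ys where "xs = [i]" "ys \<in> P" "i \<in> set ys"
      using D by auto
    then show "xs \<in> P"
      using single[of ys] by auto
  qed
next
  assume "P = (\<lambda>i. [i]) ` D"
  then show "lah_partition D D P"
    unfolding lah_partition_iff by auto
qed

lemma r_Lah_0_left: "r_Lah r 0 k = (if k = 0 then 1 else 0)"
proof -
  have "card ((\<lambda>i. [i]) ` {..<r}) = r"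
    by (simp add: card_image inj_on_def)
  then have "lah_partitions {..<r} {..<r} (k + r) = (if k = 0 then {(\<lambda>i. [i]) ` {..<r}} else {})"
    by (auto simp: lah_partitions_def lah_partition_distinguished_iff)
  then show ?thesis
    by (simp add: r_Lah_eq_card)
qed

lemma r_Lah_Suc_Suc:
  "r_Lah r (Suc n) (Suc k) = r_Lah r n k + (n + Suc k + 2 * r) * r_Lah r n (Suc k)"
proof -
  have eq: "n + Suc k + 2 * r = card {..<n + r} + Suc (k + r)"
    by simp
  show ?thesis
    unfolding r_Lah_eq_card eq add_Suc lessThan_Suc
    by (rule card_lah_partitions_insert) auto
qed

lemma r_Lah_Suc_0: "r_Lah r (Suc n) 0 = (n + 2 * r) * r_Lah r n 0"
proof (cases r)
  case 0
  have *: "r_Lah 0 (Suc j) 0 = 0" for j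
    unfolding r_Lah_eq_card add_0_right lessThan_Suc
    by (rule card_lah_partitions_insert_0) simp
  show ?thesis
    \<comment> \<open>For \<open>n = 0\<close> the factor \<open>n\<close> vanishes. For larger
      \<open>n\<close> both r-Lah numbers vanish.\<close>
    unfolding 0 by (cases n) (simp_all add: *)
next
  case (Suc s)
  have eq: "n + 2 * r = card {..<n + r} + Suc s"
    using Suc by simp
  \<comment> \<open>The new element as a block of its own would leave \<open>s = r - 1\<close>
    blocks for \<open>r\<close> distinguished elements, so this term of the recurrence drops
    out.\<close>
  have "lah_partitions {..<n + r} {..<r} s = {}"
    using Suc by (intro lah_partitions_empty) auto
  then have "card (lah_partitions {..<n + r} {..<r} s) = 0"
    by (simp only: card.empty)
  moreover have "0 + r = Suc s"
    using Suc by simp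
  ultimately show ?thesis
    unfolding r_Lah_eq_card eq add_Suc lessThan_Suc
    using card_lah_partitions_insert[of "n + r" "{..<n + r}" "{..<r}" s]
    by (simp only: lessThan_iff finite_lessThan add_0_left less_irrefl
        not_add_less2 not_False_eq_True simp_thms)
qed

lemma r_Lah_eq_0:
  assumes "n < k"
  shows "r_Lah r n k = 0"
  using assms
proof (induction n arbitrary: k)
  case 0
  then show ?case by (simp add: r_Lah_0_left)
next
  case (Suc n)
  then show ?case by (cases k) (auto simp: r_Lah_Suc_Suc)
qed

section \<open>Rising factorials in the falling factorial basis\<close>

text \<open>The product \<open>fact k * (m choose k)\<close> is the falling factorial of
  \<open>m\<close> of length \<open>k\<close>, whose next factor is \<open>m - k\<close>. Moving
  \<open>k\<close> to the right avoids truncated subtraction, and for \<open>k > m\<close> all terms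
  are zero.\<close>

lemma fact_mult_binomial_Suc:
  "m * (fact k * (m choose k)) = fact (Suc k) * (m choose Suc k) + k * (fact k * (m choose k))"
  for m k :: nat
proof (cases "k \<le> m")
  case True
  have "fact (Suc k) * (m choose Suc k) = fact k * (Suc k * (m choose Suc k))"
    by (simp only: fact_Suc of_nat_id ac_simps)
  also have "\<dots> = fact k * ((m - k) * (m choose k))"
    using binomial_absorb_comp[of m k] binomial_absorption[of k m] by simp
  finally have "fact (Suc k) * (m choose Suc k) + k * (fact k * (m choose k)) =
      (m - k + k) * (fact k * (m choose k))"
    by (simp only: distrib_left distrib_right ac_simps)
  then show ?thesis
    using True by simp
qed (simp add: binomial_eq_0)

text \<open>Passing from \<open>n\<close> to \<open>Suc n\<close> multiplies by
  \<open>m + 2 * r + n\<close>. Its summand \<open>m\<close> either raises the falling factorial or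
  contributes a factor \<open>k\<close>, matching the two terms of the recurrence.\<close>

lemma pochhammer_eq_sum_r_Lah:
  "pochhammer (m + 2 * r) n = (\<Sum>k\<le>n. r_Lah r n k * (fact k * (m choose k)))"
proof (induction n)
  case 0
  show ?case by (simp add: r_Lah_0_left)
next
  case (Suc n)
  define f where "f k = fact k * (m choose k)" for k
  have step: "m * f k = f (Suc k) + k * f k" for k
    unfolding f_def by (rule fact_mult_binomial_Suc)
  have "pochhammer (m + 2 * r) (Suc n) = (\<Sum>k\<le>n. r_Lah r n k * f k) * (m + 2 * r + n)"
    by (simp only: pochhammer_Suc Suc.IH f_def of_nat_id)
  also have "\<dots> = (\<Sum>k\<le>n. r_Lah r n k * (m * f k) + (n + 2 * r) * r_Lah r n k * f k)"
    by (simp only: sum_distrib_right) (simp add: algebra_simps)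
  also have "\<dots> = (\<Sum>k\<le>n. r_Lah r n k * f (Suc k) + (n + k + 2 * r) * r_Lah r n k * f k)"
    by (simp only: step) (simp add: algebra_simps)
  \<comment> \<open>The second sum may be extended to \<open>Suc n\<close> because
    \<open>r_Lah r n (Suc n)\<close> is zero.\<close>
  also have "\<dots> = (\<Sum>k\<le>n. r_Lah r n k * f (Suc k)) +
      (\<Sum>k\<le>Suc n. (n + k + 2 * r) * r_Lah r n k * f k)"
    by (simp add: sum.distrib r_Lah_eq_0)
  \<comment> \<open>The index 0 is split off and the rest shifted, so that both sums run over
    \<open>f (Suc k)\<close>. The isolated term is the boundary recurrence.\<close>
  also have "\<dots> = (\<Sum>k\<le>Suc n. r_Lah r (Suc n) k * f k)"
    by (simp only: sum.atMost_Suc_shift r_Lah_Suc_0 r_Lah_Suc_Suc)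
      (simp only: distrib_right sum.distrib add.assoc add_0_right add_0_left add.left_commute)
  also have "\<dots> = (\<Sum>k\<le>Suc n. r_Lah r (Suc n) k * (fact k * (m choose k)))"
    by (simp only: f_def)
  finally show ?case .
qed

section \<open>Exponential series and summation of the formula\<close>

text \<open>The terms with \<open>m < k\<close> vanish. After a shift by \<open>k\<close> the
  coefficient is \<open>1 / fact m\<close>, leaving \<open>x ^ k\<close> times the exponential
  series.\<close>

lemma binomial_exp_sums:
  fixes x :: "'a::{real_normed_field,banach}"
  shows "(\<lambda>m. of_nat (fact k * (m choose k)) / fact m * x ^ m) sums (x ^ k * exp x)"
proof -
  let ?g = "\<lambda>m. of_nat (fact k * (m choose k)) / fact m * x ^ m"
  have "?g (m + k) = x ^ k * (x ^ m /\<^sub>R fact m)" for m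
  proof -
    have "fact k * fact m * (m + k choose k) = (fact (m + k) :: nat)"
      using binomial_fact_lemma[of k "m + k"] by simp
    then have "fact m * of_nat (fact k * (m + k choose k)) = (fact (m + k) :: 'a)"
      by (metis (no_types, lifting) mult.assoc mult.left_commute of_nat_fact of_nat_mult)
    then have "of_nat (fact k * (m + k choose k)) / fact (m + k) = (1 / fact m :: 'a)"
      by (simp add: field_simps del: of_nat_mult)
    then show ?thesis
      by (simp add: power_add scaleR_conv_of_real field_simps del: of_nat_mult)
  qed
  moreover have "(\<lambda>m. x ^ k * (x ^ m /\<^sub>R fact m)) sums (x ^ k * exp x)"
    by (intro sums_mult exp_converges)
  ultimately have "(\<lambda>m. ?g (m + k)) sums (x ^ k * exp x)"
    by simp
  then show ?thesis
    by (subst (asm) sums_zero_iff_shift) auto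
qed

theorem theorem5:
  fixes n r :: nat and x :: "'a::{real_normed_field,banach}"
  shows "summable (\<lambda>k. pochhammer (of_nat (k + 2 * r)) n / fact k * x ^ k) \<and>
    Lah_Bell_poly n r x =
      exp (- x) * (\<Sum>k. pochhammer (of_nat (k + 2 * r)) n / fact k * x ^ k)"
proof -
  let ?f = "\<lambda>m. pochhammer (of_nat (m + 2 * r)) n / fact m * x ^ m"
  have "(\<lambda>m. \<Sum>k\<le>n. of_nat (r_Lah r n k) * (of_nat (fact k * (m choose k)) / fact m * x ^ m))
      sums (\<Sum>k\<le>n. of_nat (r_Lah r n k) * (x ^ k * exp x))"
    by (intro sums_sum sums_mult binomial_exp_sums)
  \<comment> \<open>The rising factorial is taken back to the natural numbers, where its expansion
    in falling factorials holds for each \<open>m\<close>.\<close>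
  also have "(\<lambda>m. \<Sum>k\<le>n. of_nat (r_Lah r n k) * (of_nat (fact k * (m choose k)) / fact m * x ^ m))
      = ?f"
    by (simp only: pochhammer_of_nat pochhammer_eq_sum_r_Lah of_nat_sum of_nat_mult
        sum_distrib_right sum_divide_distrib times_divide_eq_right mult.assoc times_divide_eq_left)
  also have "(\<Sum>k\<le>n. of_nat (r_Lah r n k) * (x ^ k * exp x)) = Lah_Bell_poly n r x * exp x"
    by (simp add: Lah_Bell_poly_def sum_distrib_right mult.assoc)
  finally have "?f sums (Lah_Bell_poly n r x * exp x)" .
  then have "summable ?f" and "suminf ?f = Lah_Bell_poly n r x * exp x"
    by (simp_all add: sums_iff)
  then show ?thesis
    by (simp add: exp_minus)
qed

end
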